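(* Let $\Gamma$ be a vertex transitive graph on $n$ vertices and $G$ its automorphism group. Let $A$ be the adjacency matrix of $\Gamma$ and let $\lambda$ be an eigenvalue of $A$ of multiplicity $m$. Assume $\lambda$ is rational, let $V_\lambda \subset \mathbb{R}^n$ be the $m$-dimensional eigenspace of $A$ corresponding to $\lambda$, and let $P_\lambda$ be the (rational) matrix of the orthogonal projection of $\mathbb{R}^n$ onto $V_\lambda$. Then $L_{\Gamma,\lambda} := P_\lambda \mathbb{Z}^n$ is a lattice of full rank in $V_\lambda$, and its automorphism group contains a subgroup isomorphic to a factor group of $G$. If $\Gamma$ is distance transitive, then $L_{\Gamma,\lambda}$ is strongly eutactic.
   Context: Graphs are finite and simple, with vertices labeled $1,\dots,n$; the adjacency matrix $A=(a_{ij})$ has $a_{ij}=1$ if $i,j$ are joined by an edge and $a_{ij}=0$ otherwise. $\Gamma$ is vertex transitive if for every pair of vertices $i,j$ there is $\tau\in\operatorname{Aut}(\Gamma)$ with $\tau(i)=j$. The distance between two vertices is the number of edges in a shortest path connecting them. A connected graph $\Gamma$ is distance transitive if for any two pairs of vertices $i,j$ and $k,l$ at the same distance from each other there is $\tau \in \operatorname{Aut}(\Gamma)$ with $\tau(i)=k$ and $\tau(j)=l$. The space $V_\lambda$ carries the Euclidean inner product of $\mathbb{R}^n$ and is identified with $\mathbb{R}^m$. A lattice of full rank in a Euclidean space $V$ is a discrete co-compact subgroup of $V$; its automorphism group is the group of all orthogonal transformations of $V$ that map the lattice to itself. For a lattice $L$ of full rank in $V$, let $|L| = \min\{\|x\|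 : x\in L\setminus\{0\}\}$ and $S(L) = \{x\in L : \|x\|=|L|\}$. $L$ is strongly eutactic if there is a real constant $c>0$ such that $\|v\|^2 = c\sum_{x\in S(L)}\langle v,x\rangle^2$ for all $v\in V$. *)

theory Defs
  imports "HOL-Analysis.Analysis" "HOL-Algebra.Bij" "HOL-Algebra.Coset"
begin

section \<open>Graphs\<close>

text \<open>
  A finite simple graph is an adjacency relation on a finite type \<open>'n\<close>, all of whose elements
  are vertices; the number of vertices is \<open>CARD('n)\<close>.
\<close>

definition simple_graph :: "('n::finite \<Rightarrow> 'n \<Rightarrow> bool) \<Rightarrow> bool"
  where "simple_graph E \<longleftrightarrow> symp E \<and> irreflp E"

definition adjacency_matrix :: "('n::finite \<Rightarrow> 'n \<Rightarrow> bool) \<Rightarrow> real ^ 'n ^ 'n"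
  where "adjacency_matrix E = (\<chi> i j. if E i j then 1 else 0)"

definition graph_auts :: "('n::finite \<Rightarrow> 'n \<Rightarrow> bool) \<Rightarrow> ('n \<Rightarrow> 'n) set"
  where "graph_auts E = {\<tau>. bij \<tau> \<and> (\<forall>i j. E (\<tau> i) (\<tau> j) \<longleftrightarrow> E i j)}"

definition graph_aut_group :: "('n::finite \<Rightarrow> 'n \<Rightarrow> bool) \<Rightarrow> ('n \<Rightarrow> 'n) monoid"
  where "graph_aut_group E = (BijGroup UNIV)\<lparr>carrier := graph_auts E\<rparr>"

definition vertex_transitive :: "('n::finite \<Rightarrow> 'n \<Rightarrow> bool) \<Rightarrow> bool"
  where "vertex_transitive E \<longleftrightarrow> (\<forall>i j. \<exists>\<tau>\<in>graph_auts E. \<tau> i = j)"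

text \<open>A path is the list of its vertices, so a path with \<open>k\<close> edges has length \<open>k + 1\<close>.\<close>

definition graph_path :: "('n::finite \<Rightarrow> 'n \<Rightarrow> bool) \<Rightarrow> 'n \<Rightarrow> 'n list \<Rightarrow> 'n \<Rightarrow> bool"
  where "graph_path E i xs j \<longleftrightarrow>
    xs \<noteq> [] \<and> hd xs = i \<and> last xs = j \<and> distinct xs \<and> successively E xs"

definition graph_connected :: "('n::finite \<Rightarrow> 'n \<Rightarrow> bool) \<Rightarrow> bool"
  where "graph_connected E \<longleftrightarrow> (\<forall>i j. \<exists>xs. graph_path E i xs j)"

text \<open>Meaningful only if some path joins \<open>i\<close> and \<open>j\<close>; it is used only for connected graphs.\<close>

definition graph_dist :: "('n::finite \<Rightarrow> 'n \<Rightarrow> bool) \<Rightarrow> 'n \<Rightarrow> 'n \<Rightarrow> nat"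
  where "graph_dist E i j = (LEAST k. \<exists>xs. graph_path E i xs j \<and> length xs = Suc k)"

definition distance_transitive :: "('n::finite \<Rightarrow> 'n \<Rightarrow> bool) \<Rightarrow> bool"
  where "distance_transitive E \<longleftrightarrow> graph_connected E \<and>
    (\<forall>i j k l. graph_dist E i j = graph_dist E k l \<longrightarrow>
      (\<exists>\<tau>\<in>graph_auts E. \<tau> i = k \<and> \<tau> j = l))"

section \<open>Eigenspaces and orthogonal projections\<close>

definition eigenspace :: "real ^ 'n ^ 'n \<Rightarrow> real \<Rightarrow> (real ^ 'n) set"
  where "eigenspace A l = {v. A *v v = l *\<^sub>R v}"

definition is_eigenvalue :: "real ^ 'n ^ 'n \<Rightarrow> real \<Rightarrow> bool"
  where "is_eigenvalue A l \<longleftrightarrow> (\<exists>v. v \<noteq> 0 \<and> A *v v = l *\<^sub>R v)"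

definition orth_proj :: "'a::euclidean_space set \<Rightarrow> 'a \<Rightarrow> 'a"
  where "orth_proj V x = (THE y. y \<in> V \<and> (\<forall>v\<in>V. orthogonal (x - y) v))"

definition proj_matrix :: "(real ^ 'n::finite) set \<Rightarrow> real ^ 'n ^ 'n"
  where "proj_matrix V = matrix (orth_proj V)"

lemma orth_proj_unique:
  assumes "subspace V" "y \<in> V" "\<And>v. v \<in> V \<Longrightarrow> orthogonal (x - y) v"
    and "y' \<in> V" "\<And>v. v \<in> V \<Longrightarrow> orthogonal (x - y') v"
  shows "y = y'"
proof -
  have d: "y - y' \<in> V"
    using assms by (simp add: subspace_diff)
  have "(y - y') \<bullet> (y - y') = (x - y') \<bullet> (y - y') - (x - y) \<bullet> (y - y')"
    by (simp add: algebra_simps)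
  also have "\<dots> = 0"
    using assms(3)[OF d] assms(5)[OF d] by (simp add: orthogonal_def)
  finally show ?thesis by simp
qed

lemma orth_proj:
  assumes "subspace V"
  shows "orth_proj V x \<in> V" and "v \<in> V \<Longrightarrow> orthogonal (x - orth_proj V x) v"
proof -
  obtain y z where "y \<in> span V" "\<And>w. w \<in> span V \<Longrightarrow> orthogonal z w" "x = y + z"
    using orthogonal_subspace_decomp_exists by blast
  then have ex: "y \<in> V \<and> (\<forall>v\<in>V. orthogonal (x - y) v)"
    using assms by (metis add_diff_cancel_left' span_eq_iff)
  have "orth_proj V x \<in> V \<and> (\<forall>v\<in>V. orthogonal (x - orth_proj V x) v)"
    unfolding orth_proj_def
  proof (rule theI)
    show "y \<in> V \<and> (\<forall>v\<in>V. orthogonal (x - y) v)" by (rule ex)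
  next
    fix y' assume "y' \<in> V \<and> (\<forall>v\<in>V. orthogonal (x - y') v)"
    with ex show "y' = y"
      using orth_proj_unique[OF assms, of y' x y] by blast
  qed
  then show "orth_proj V x \<in> V" and "v \<in> V \<Longrightarrow> orthogonal (x - orth_proj V x) v"
    by auto
qed

section \<open>Lattices\<close>

definition quotient_topology :: "'a topology \<Rightarrow> ('a \<Rightarrow> 'b) \<Rightarrow> 'b topology"
  where "quotient_topology X q =
    topology (\<lambda>U. U \<subseteq> q ` topspace X \<and> openin X {x \<in> topspace X. q x \<in> U})"

lemma openin_quotient_topology:
  "openin (quotient_topology X q) U \<longleftrightarrow>
    U \<subseteq> q ` topspace X \<and> openin X {x \<in> topspace X. q x \<in> U}"
proof -
  have "istopology (\<lambda>U. U \<subseteq> q ` topspace X \<and> openin X {x \<in> topspace X. q x \<in> U})"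
    unfolding istopology_def
  proof (intro conjI allI impI)
    fix S T
    assume *: "S \<subseteq> q ` topspace X \<and> openin X {x \<in> topspace X. q x \<in> S}"
      "T \<subseteq> q ` topspace X \<and> openin X {x \<in> topspace X. q x \<in> T}"
    then show "S \<inter> T \<subseteq> q ` topspace X" by auto
    have "{x \<in> topspace X. q x \<in> S \<inter> T} =
        {x \<in> topspace X. q x \<in> S} \<inter> {x \<in> topspace X. q x \<in> T}"
      by auto
    with * show "openin X {x \<in> topspace X. q x \<in> S \<inter> T}" by auto
  next
    fix K
    assume *: "\<forall>S\<in>K. S \<subseteq> q ` topspace X \<and> openin X {x \<in> topspace X. q x \<in> S}"
    then show "\<Union>K \<subseteq> q ` topspace X" by auto
    have "{x \<in> topspace X. q x \<in> \<Union>K} = (\<Union>S\<in>K. {x \<in> topspace X. q x \<in> S})"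
      by auto
    with * show "openin X {x \<in> topspace X. q x \<in> \<Union>K}" by auto
  qed
  then show ?thesis
    by (simp add: quotient_topology_def topology_inverse')
qed

lemma quotient_map_quotient_topology: "quotient_map X (quotient_topology X q) q"
proof -
  have "{x \<in> topspace X. q x \<in> q ` topspace X} = topspace X"
    by auto
  then have "openin (quotient_topology X q) (q ` topspace X)"
    by (simp add: openin_quotient_topology)
  then have "topspace (quotient_topology X q) = q ` topspace X"
    by (meson openin_quotient_topology openin_subset openin_topspace subset_antisym)
  then show ?thesis
    by (auto simp: quotient_map_def openin_quotient_topology)
qed

text \<open>The quotient group \<open>V / L\<close> is the space of cosets \<open>x + L\<close> with the quotient topology.\<close>

definition full_rank_lattice :: "'a::euclidean_space set \<Rightarrow> 'a set \<Rightarrow> bool"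
  where "full_rank_lattice V L \<longleftrightarrow>
    L \<subseteq> V \<and> 0 \<in> L \<and> (\<forall>x\<in>L. \<forall>y\<in>L. x + y \<in> L) \<and> (\<forall>x\<in>L. - x \<in> L) \<and>
    discrete L \<and>
    compact_space (quotient_topology (top_of_set V) (\<lambda>x. (+) x ` L))"

text \<open>
  Orthogonal transformations of a subspace \<open>V\<close> are functions on \<open>V\<close>, represented as in
  \<^const>\<open>Bij\<close> by functions that are undefined outside \<open>V\<close>.
\<close>

definition orthogonal_transformations_on :: "'a::euclidean_space set \<Rightarrow> ('a \<Rightarrow> 'a) set"
  where "orthogonal_transformations_on V = {f \<in> Bij V.
    (\<forall>x\<in>V. \<forall>y\<in>V. f (x + y) = f x + f y) \<and>
    (\<forall>c. \<forall>x\<in>V. f (c *\<^sub>R x) = c *\<^sub>R f x) \<and>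
    (\<forall>x\<in>V. \<forall>y\<in>V. f x \<bullet> f y = x \<bullet> y)}"

definition lattice_aut_group :: "'a::euclidean_space set \<Rightarrow> 'a set \<Rightarrow> ('a \<Rightarrow> 'a) monoid"
  where "lattice_aut_group V L =
    (BijGroup V)\<lparr>carrier := {f \<in> orthogonal_transformations_on V. f ` L = L}\<rparr>"

definition lattice_min :: "'a::euclidean_space set \<Rightarrow> real"
  where "lattice_min L = (LEAST r. \<exists>x\<in>L - {0}. r = norm x)"

definition min_vectors :: "'a::euclidean_space set \<Rightarrow> 'a set"
  where "min_vectors L = {x \<in> L. norm x = lattice_min L}"

definition strongly_eutactic :: "'a::euclidean_space set \<Rightarrow> 'a set \<Rightarrow> bool"
  where "strongly_eutactic V L \<longleftrightarrow>
    (\<exists>c>0. \<forall>v\<in>V. (norm v)\<^sup>2 = c * (\<Sum>x\<in>min_vectors L. (v \<bullet> x)\<^sup>2))"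

definition integer_vectors :: "(real ^ 'n) set"
  where "integer_vectors = {z. \<forall>i. z $ i \<in> \<int>}"

definition graph_eigenspace :: "('n::finite \<Rightarrow> 'n \<Rightarrow> bool) \<Rightarrow> real \<Rightarrow> (real ^ 'n) set"
  where "graph_eigenspace E l = eigenspace (adjacency_matrix E) l"

definition graph_lattice :: "('n::finite \<Rightarrow> 'n \<Rightarrow> bool) \<Rightarrow> real \<Rightarrow> (real ^ 'n) set"
  where "graph_lattice E l = (\<lambda>z. proj_matrix (graph_eigenspace E l) *v z) ` integer_vectors"

end

theory Submission
  imports Defs
begin

text \<open>
  The projection of a rational vector \<open>x\<close> to the kernel of a symmetric rational matrix \<open>B\<close> is
  \<open>x - B w\<close> for any solution \<open>w\<close> of the rational system \<open>B (B w) = B x\<close>, and a real solution can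
  be replaced by a rational one. With a common denominator \<open>d\<close> of the entries of the projection
  \<open>P\<close>, the image of the integer vectors lies in \<open>1/d\<close> times the integer vectors, so it is discrete, and
  it is co-compact because \<open>v = P (v - \<lfloor>v\<rfloor>) + P \<lfloor>v\<rfloor>\<close> for \<open>v\<close> in the eigenspace. Permuting
  coordinates by graph automorphisms is orthogonal, commutes with \<open>A\<close>, hence with \<open>P\<close>, and preserves
  the integer vectors. Finally, the matrix \<open>\<Sum>x x\<^sup>T\<close> over the minimal vectors is invariant under all
  automorphisms, so for a distance transitive graph its entries depend only on the distance, and it is
  a polynomial in \<open>A\<close>, which acts on the eigenspace as a scalar.
\<close>

section \<open>Rational orthogonal projections\<close>

text \<open>The reals form a vector space over \<open>rat\<close> in which \<open>{1}\<close> is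
  independent. \<open>construct\<close> extends it to a basis and sends the other basis vectors to
  0, giving a linear retraction of the reals onto the rationals.\<close>

lemma rational_valued_functional:
  obtains \<phi> :: "real \<Rightarrow> real"
  where "\<And>x y. \<phi> (x + y) = \<phi> x + \<phi> y" "\<And>q x. q \<in> \<rat> \<Longrightarrow> \<phi> (q * x) = q * \<phi> x"
    "\<phi> 1 = 1" "\<And>x. \<phi> x \<in> \<rat>"
proof -
  let ?s = "\<lambda>q x. of_rat q * x :: real" and ?t = "(*) :: rat \<Rightarrow> rat \<Rightarrow> rat"
  interpret vector_space_pair ?s ?t
    by unfold_locales (auto simp: algebra_simps of_rat_add of_rat_mult)
  have ind: "vs1.independent {1}"
    by (simp add: vs1.dependent_single)
  let ?f = "construct {1} (\<lambda>_. 1)"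
  have lin: "Vector_Spaces.linear ?s ?t ?f"
    by (rule linear_construct[OF ind])
  show thesis
  proof
    show "of_rat (?f (x + y)) = (of_rat (?f x) + of_rat (?f y) :: real)" for x y
      by (simp add: module_hom.add[OF lin[unfolded linear_iff_module_hom]] of_rat_add)
    show "of_rat (?f (q * x)) = q * of_rat (?f x)" if "q \<in> \<rat>" for q x
      using that module_hom.scale[OF lin[unfolded linear_iff_module_hom]] by (auto elim!: Rats_cases simp: of_rat_mult)
    show "of_rat (?f 1) = (1 :: real)"
      by (simp add: construct_basis[OF ind])
  qed simp
qed

text \<open>Applying a rational-valued functional to the coordinates of a real solution keeps it a solution.\<close>

lemma rational_linear_system:
  fixes M :: "real ^ 'n ^ 'm"
  assumes "\<And>i j. M $ i $ j \<in> \<rat>" "\<And>i. (M *v w) $ i \<in> \<rat>"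
  obtains w' where "\<And>j. w' $ j \<in> \<rat>" "M *v w' = M *v w"
proof -
  obtain \<phi> :: "real \<Rightarrow> real"
    where add: "\<And>x y. \<phi> (x + y) = \<phi> x + \<phi> y"
      and scale: "\<And>q x. q \<in> \<rat> \<Longrightarrow> \<phi> (q * x) = q * \<phi> x"
      and one: "\<phi> 1 = 1" and rat: "\<And>x. \<phi> x \<in> \<rat>"
    by (rule rational_valued_functional) blast
  have zero: "\<phi> 0 = 0"
    using add[of 0 0] by simp
  have fixed: "\<phi> q = q" if "q \<in> \<rat>" for q
    using scale[OF that, of 1] one by simp
  have sum: "\<phi> (\<Sum>j\<in>S. f j) = (\<Sum>j\<in>S. \<phi> (f j))" if "finite S" for S and f :: "'n \<Rightarrow> real"
    using that by induction (auto simp: zero add)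
  have "M *v (\<chi> j. \<phi> (w $ j)) = M *v w"
  proof (rule vec_eq_iff[THEN iffD2], rule allI)
    fix i
    \<comment> \<open>Rational entries of \<open>M\<close> may be pulled out of
      \<open>\<phi>\<close>, so \<open>\<phi>\<close> passes through each row sum.\<close>
    have "(M *v (\<chi> j. \<phi> (w $ j))) $ i = \<phi> ((M *v w) $ i)"
      by (simp add: matrix_vector_mult_def sum scale assms(1))
    then show "(M *v (\<chi> j. \<phi> (w $ j))) $ i = (M *v w) $ i"
      using fixed[OF assms(2)] by simp
  qed
  with rat show thesis
    by (intro that[of "\<chi> j. \<phi> (w $ j)"]) auto
qed

section \<open>Linearity of the orthogonal projection and its matrix\<close>

lemma orth_proj_eqI:
  assumes "subspace V" "y \<in> V" "\<And>v. v \<in> V \<Longrightarrow> orthogonal (x - y) v"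
  shows "orth_proj V x = y"
  using orth_proj_unique[OF assms(1)] orth_proj[OF assms(1)] assms by metis

lemma orth_proj_same:
  assumes "subspace V" "v \<in> V"
  shows "orth_proj V v = v"
  by (rule orth_proj_eqI) (use assms in \<open>auto simp: orthogonal_def\<close>)

lemma linear_orth_proj:
  assumes "subspace V"
  shows "linear (orth_proj V)"
proof
  note P = orth_proj[OF assms]
  show "orth_proj V (x + y) = orth_proj V x + orth_proj V y" for x y
  proof (rule orth_proj_eqI[OF assms])
    show "orth_proj V x + orth_proj V y \<in> V"
      using assms P(1) by (simp add: subspace_add)
    show "orthogonal (x + y - (orth_proj V x + orth_proj V y)) v" if "v \<in> V" for v
      using P(2)[OF that, of x] P(2)[OF that, of y] by (simp add: orthogonal_def algebra_simps)
  qed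
  show "orth_proj V (c *\<^sub>R x) = c *\<^sub>R orth_proj V x" for c x
  proof (rule orth_proj_eqI[OF assms])
    show "c *\<^sub>R orth_proj V x \<in> V"
      using assms P(1) by (simp add: subspace_scale)
    show "orthogonal (c *\<^sub>R x - c *\<^sub>R orth_proj V x) v" if "v \<in> V" for v
      using P(2)[OF that, of x]
      by (simp add: orthogonal_def flip: scaleR_diff_right)
  qed
qed

lemma proj_matrix_mult:
  assumes "subspace V"
  shows "proj_matrix V *v x = orth_proj V x"
  unfolding proj_matrix_def using linear_orth_proj[OF assms] by (simp add: matrix_works)

lemma symmetric_matrix_inner:
  fixes B :: "real ^ 'n ^ 'n"
  assumes "transpose B = B"
  shows "(B *v x) \<bullet> y = x \<bullet> (B *v y)"
  by (metis assms dot_lmul_matrix vector_transpose_matrix)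

lemma orth_proj_kernel_rational:
  fixes B :: "real ^ 'n ^ 'n"
  assumes sym: "transpose B = B" and B: "\<And>i j. B $ i $ j \<in> \<rat>" and x: "\<And>i. x $ i \<in> \<rat>"
  shows "orth_proj {v. B *v v = 0} x $ i \<in> \<rat>"
proof -
  let ?V = "{v. B *v v = 0}"
  note sym = symmetric_matrix_inner[OF sym]
  have V: "subspace ?V"
    by (simp add: subspace_def matrix_vector_right_distrib matrix_vector_mult_scaleR)
  have mult_rat: "(B *v u) $ k \<in> \<rat>" if "\<And>j. u $ j \<in> \<rat>" for u k
    using B that by (auto simp: matrix_vector_mult_def intro!: Rats_sum)
  \<comment> \<open>The equation puts \<open>x - B *v w\<close> into the kernel, and by symmetry
    \<open>B *v w\<close> is orthogonal to the kernel.\<close>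
  have proj: "orth_proj ?V x = x - B *v w" if "B *v (B *v w) = B *v x" for w
    using that
    by (intro orth_proj_eqI[OF V]) (auto simp: orthogonal_def sym matrix_vector_mult_diff_distrib)
  \<comment> \<open>A real solution comes from splitting \<open>x\<close> along the range of
    \<open>B\<close>.\<close>
  obtain y z where y: "y \<in> span (range ((*v) B))"
    and z: "\<And>u. u \<in> span (range ((*v) B)) \<Longrightarrow> orthogonal z u" and xyz: "x = y + z"
    using orthogonal_subspace_decomp_exists[of "range ((*v) B)" x] by blast
  have "span (range ((*v) B)) = range ((*v) B)"
    by (simp add: linear_subspace_image subspace_UNIV)
  with y obtain w where w: "y = B *v w"
    by auto
  \<comment> \<open>By symmetry this is the squared norm of \<open>B *v z\<close>, so
    \<open>z\<close> lies in the kernel.\<close>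
  have "z \<bullet> (B *v (B *v z)) = 0"
    using z[OF span_base, of "B *v (B *v z)"] by (simp add: orthogonal_def)
  then have "B *v z = 0"
    using sym[of z "B *v z"] by simp
  with xyz w have w: "(B ** B) *v w = B *v x"
    by (simp add: matrix_vector_right_distrib matrix_vector_mul_assoc)
  obtain w' where w': "\<And>j. w' $ j \<in> \<rat>" "(B ** B) *v w' = (B ** B) *v w"
  proof (rule rational_linear_system)
    show "(B ** B) $ i $ j \<in> \<rat>" for i j
      using B by (auto simp: matrix_matrix_mult_def intro!: Rats_sum)
    show "((B ** B) *v w) $ i \<in> \<rat>" for i
      unfolding w by (rule mult_rat[OF x])
  qed blast
  have "orth_proj ?V x = x - B *v w'"
    using w' w by (intro proj) (simp add: matrix_vector_mul_assoc)
  then show ?thesis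
    using x mult_rat[OF w'(1)] by simp
qed

lemma eigenspace_eq_kernel: "eigenspace A l = {v. (A - l *\<^sub>R mat 1) *v v = 0}"
  by (auto simp: eigenspace_def matrix_vector_mult_diff_rdistrib simp flip: scaleR_matrix_vector_assoc)

lemma subspace_eigenspace: "subspace (eigenspace A l)"
  by (simp add: eigenspace_eq_kernel subspace_def matrix_vector_right_distrib
      matrix_vector_mult_scaleR)

text \<open>The eigenspace is the kernel of \<open>A - l *\<^sub>R mat 1\<close>, which is symmetric
  and, since \<open>l\<close> is rational, has rational entries. Column \<open>j\<close> of the
  projection matrix is the projection of \<open>axis j 1\<close>.\<close>

lemma proj_matrix_eigenspace_rational:
  assumes "transpose A = A" "\<And>i j. A $ i $ j \<in> \<rat>" "l \<in> \<rat>"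
  shows "proj_matrix (eigenspace A l) $ i $ j \<in> \<rat>"
proof -
  have "transpose (A - l *\<^sub>R mat 1) = A - l *\<^sub>R mat 1"
    using assms(1) by (simp add: transpose_def vec_eq_iff mat_def)
  then have "orth_proj (eigenspace A l) (axis j 1) $ i \<in> \<rat>"
    unfolding eigenspace_eq_kernel using assms(2,3)
    by (intro orth_proj_kernel_rational) (auto simp: mat_def axis_def)
  then show ?thesis
    by (simp add: proj_matrix_def matrix_def)
qed

section \<open>Rational lattices\<close>

lemma common_denominator:
  assumes "finite S" "S \<subseteq> \<rat>"
  obtains d :: nat where "d > 0" "\<And>x. x \<in> S \<Longrightarrow> real d * x \<in> \<int>"
proof -
  have "\<exists>d::nat. d > 0 \<and> (\<forall>x\<in>S. real d * x \<in> \<int>)"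
    using assms
  proof induction
    case empty
    show ?case by auto
  next
    case (insert x S)
    then obtain d :: nat where d: "d > 0" "\<forall>x\<in>S. real d * x \<in> \<int>" and "x \<in> \<rat>"
      by auto
    from \<open>x \<in> \<rat>\<close> obtain a :: int and b :: nat where b: "b \<noteq> 0" "x = of_int a / real b"
      by (auto simp: Rats_eq_int_div_nat)
    have "real (d * b) * y \<in> \<int>" if "y \<in> insert x S" for y
    proof (cases "y = x")
      case True
      with b have "real (d * b) * y = of_int (int d * a)"
        by simp
      then show ?thesis by (metis Ints_of_int)
    next
      case False
      with that d have "real d * y \<in> \<int>" by auto
      then have "of_nat b * (real d * y) \<in> \<int>"
        by (rule Ints_mult[OF Ints_of_nat])
      then show ?thesis by (simp add: ac_simps)
    qed
    with d b show ?case
      by (intro exI[of _ "d * b"]) auto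
  qed
  then show thesis using that by blast
qed

text \<open>One radius serves all points. Unlike \<open>discrete\<close>, this also excludes limit
  points outside \<open>L\<close>, so that bounded parts of \<open>L\<close> are finite.\<close>

definition uniformly_discrete :: "'a::metric_space set \<Rightarrow> bool"
  where "uniformly_discrete L \<longleftrightarrow> (\<exists>e>0. \<forall>x\<in>L. \<forall>y\<in>L. dist x y < e \<longrightarrow> x = y)"

lemma uniformly_discrete_imp_discrete:
  assumes "uniformly_discrete L"
  shows "discrete L"
proof -
  obtain e where e: "e > 0" "\<forall>x\<in>L. \<forall>y\<in>L. dist x y < e \<longrightarrow> x = y"
    using assms by (auto simp: uniformly_discrete_def)
  show ?thesis
    unfolding discrete_def isolated_in_def
  proof safe
    fix x assume "x \<in> L"
    with e show "\<exists>T. open T \<and> T \<inter> L = {x}"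
      by (intro exI[of _ "ball x e"]) (auto, metis)
  qed
qed

text \<open>By Bolzano-Weierstrass an infinite bounded part would have a limit point, against the
  uniform separation.\<close>

lemma uniformly_discrete_bounded_finite:
  fixes L :: "'a::heine_borel set"
  assumes "uniformly_discrete L" "bounded B"
  shows "finite (L \<inter> B)"
proof (rule ccontr)
  obtain e where e: "e > 0" "\<forall>x\<in>L. \<forall>y\<in>L. dist x y < e \<longrightarrow> x = y"
    using assms by (auto simp: uniformly_discrete_def)
  assume inf: "infinite (L \<inter> B)"
  moreover have "bounded (L \<inter> B)"
    using assms(2) bounded_subset by blast
  ultimately obtain x where "x islimpt (L \<inter> B)"
    by (meson bounded_infinite_imp_islimpt inf_le1 order_refl)
  then show False
    using discrete_imp_not_islimpt[OF e(1), of "L \<inter> B" x] e(2)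
    by (metis IntD1 dist_commute)
qed

text \<open>With \<open>d\<close> a common denominator of the entries of \<open>P\<close>,
  coordinates of image points are multiples of \<open>1 / d\<close>, so two points closer than
  \<open>1 / d\<close> agree in every coordinate.\<close>

lemma uniformly_discrete_rational_image:
  fixes P :: "real ^ 'n ^ 'm"
  assumes "\<And>i j. P $ i $ j \<in> \<rat>"
  shows "uniformly_discrete ((\<lambda>z. P *v z) ` integer_vectors)"
proof -
  obtain d :: nat where d: "d > 0" "\<And>x. x \<in> (\<Union>i. range (($) (P $ i))) \<Longrightarrow> real d * x \<in> \<int>"
    using common_denominator[of "\<Union>i. range (($) (P $ i))"] assms by (auto simp: image_subset_iff)
  have int: "real d * (P *v z) $ i \<in> \<int>" if "z \<in> integer_vectors" for z i
  proof -
    have "real d * (P *v z) $ i = (\<Sum>j\<in>UNIV. (real d * P $ i $ j) * z $ j)"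
      by (simp add: matrix_vector_mult_def sum_distrib_left mult.assoc)
    also have "\<dots> \<in> \<int>"
      using that by (intro Ints_sum Ints_mult d(2)) (auto simp: integer_vectors_def)
    finally show ?thesis .
  qed
  have "P *v z = P *v z'"
    if z: "z \<in> integer_vectors" "z' \<in> integer_vectors" and "dist (P *v z) (P *v z') < 1 / d" for z z'
  proof (rule vec_eq_iff[THEN iffD2], rule allI)
    fix i
    let ?t = "(P *v z) $ i - (P *v z') $ i"
    have "\<bar>?t\<bar> < 1 / d"
      using that(3) component_le_norm_cart[of "P *v z - P *v z'" i] by (simp add: dist_norm)
    then have "\<bar>real d * ?t\<bar> < 1"
      using d(1) by (simp only: abs_mult) (simp add: field_simps)
    moreover have "real d * ?t \<in> \<int>"
      using int[OF z(1), of i] int[OF z(2), of i] by (simp add: right_diff_distrib)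
    ultimately have "real d * ?t = 0"
      using Ints_nonzero_abs_less1 by blast
    with d(1) show "(P *v z) $ i = (P *v z') $ i" by simp
  qed
  with d(1) show ?thesis
    unfolding uniformly_discrete_def by (intro exI[of _ "1 / real d"]) auto
qed

text \<open>Allows a point to be moved by a lattice vector into a compact set without changing its
  class in the quotient.\<close>

lemma coset_eqI:
  fixes L :: "'a::ab_group_add set"
  assumes add: "\<forall>x\<in>L. \<forall>y\<in>L. x + y \<in> L" and minus: "\<forall>x\<in>L. - x \<in> L" and l: "l \<in> L"
  shows "(+) (x + l) ` L = (+) x ` L"
proof safe
  fix y assume "y \<in> L"
  show "x + l + y \<in> (+) x ` L"
    using add l \<open>y \<in> L\<close> by (intro image_eqI[of _ _ "l + y"]) (auto simp: add.assoc)
  show "x + y \<in> (+) (x + l) ` L"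
  proof (rule image_eqI[of _ _ "- l + y"])
    show "- l + y \<in> L" using add minus l \<open>y \<in> L\<close> by blast
  qed simp
qed

lemma full_rank_lattice_proj:
  fixes V :: "(real ^ 'n::finite) set"
  assumes V: "subspace V" and rat: "\<And>i j. proj_matrix V $ i $ j \<in> \<rat>"
  shows "full_rank_lattice V ((\<lambda>z. proj_matrix V *v z) ` integer_vectors)"
    (is "full_rank_lattice V ?L")
proof -
  let ?P = "\<lambda>z. proj_matrix V *v z" and ?q = "\<lambda>x. (+) x ` ?L"
  have sub: "?L \<subseteq> V"
    using orth_proj(1)[OF V] by (auto simp: proj_matrix_mult[OF V])
  have zero: "0 \<in> ?L"
    by (rule image_eqI[of _ _ 0]) (auto simp: integer_vectors_def)
  have add: "\<forall>x\<in>?L. \<forall>y\<in>?L. x + y \<in> ?L"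
    by (auto simp: integer_vectors_def simp flip: matrix_vector_right_distrib intro!: imageI)
  have minus: "\<forall>x\<in>?L. - x \<in> ?L"
  proof clarify
    fix z :: "real ^ 'n" assume "z \<in> integer_vectors"
    then show "- ?P z \<in> ?L"
      by (intro image_eqI[of _ _ "- z"])
        (auto simp: integer_vectors_def matrix_vector_mult_def vec_eq_iff sum_negf)
  qed
  \<comment> \<open>The projected unit cube is compact and meets every coset, so the quotient is its
    continuous image.\<close>
  let ?K = "?P ` cbox 0 1"
  have K: "compact ?K"
    by (intro compact_continuous_image linear_continuous_on matrix_vector_mul_bounded_linear compact_cbox)
  have KV: "?K \<subseteq> V"
    using orth_proj(1)[OF V] by (auto simp: proj_matrix_mult[OF V])
  have qm: "quotient_map (top_of_set V) (quotient_topology (top_of_set V) ?q) ?q"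
    by (rule quotient_map_quotient_topology)
  have "compactin (top_of_set V) ?K"
    using K KV by (simp add: compactin_subtopology)
  then have comp: "compactin (quotient_topology (top_of_set V) ?q) (?q ` ?K)"
    by (rule image_compactin) (rule quotient_imp_continuous_map[OF qm])
  have "?q ` ?K = ?q ` V"
  proof
    show "?q ` ?K \<subseteq> ?q ` V" using KV by blast
    show "?q ` V \<subseteq> ?q ` ?K"
    proof clarify
      fix v assume "v \<in> V"
      \<comment> \<open>Rounding down leaves \<open>v - z\<close> in the unit cube, while
        \<open>?P z\<close> is a lattice vector.\<close>
      define z :: "real ^ 'n" where "z = (\<chi> i. of_int \<lfloor>v $ i\<rfloor>)"
      have "v = ?P v"
        using \<open>v \<in> V\<close> V by (simp add: proj_matrix_mult orth_proj_same)
      also have "\<dots> = ?P (v - z) + ?P z"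
        by (simp flip: matrix_vector_right_distrib)
      finally have v: "v = ?P (v - z) + ?P z" .
      have "?P z \<in> ?L"
        by (simp add: z_def integer_vectors_def)
      then have "?q v = ?q (?P (v - z))"
        by (subst v) (rule coset_eqI[OF add minus])
      moreover have "v - z \<in> cbox 0 1"
        by (auto simp: mem_box_cart z_def) linarith+
      ultimately show "?q v \<in> ?q ` ?K" by blast
    qed
  qed
  then have "?q ` ?K = topspace (quotient_topology (top_of_set V) ?q)"
    using quotient_imp_surjective_map[OF qm] by simp
  with comp have "compact_space (quotient_topology (top_of_set V) ?q)"
    by (simp add: compact_space_def)
  moreover have "discrete ?L"
    by (intro uniformly_discrete_imp_discrete uniformly_discrete_rational_image rat)
  ultimately show ?thesis
    using sub zero add minus unfolding full_rank_lattice_def by blast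
qed

text \<open>The \<open>LEAST\<close> over the reals in \<open>lattice_min\<close> is informative
  only if the minimum is attained. It is, because a ball contains finitely many points of
  \<open>L\<close>.\<close>

lemma
  fixes L :: "'a::euclidean_space set"
  assumes "uniformly_discrete L" "x \<in> L" "x \<noteq> 0"
  shows finite_min_vectors: "finite (min_vectors L)"
    and min_vectors_nonzero: "\<exists>y\<in>min_vectors L. y \<noteq> 0"
proof -
  have fin: "finite (L \<inter> cball 0 r)" for r
    by (rule uniformly_discrete_bounded_finite[OF assms(1) bounded_cball])
  show "finite (min_vectors L)"
    by (rule finite_subset[OF _ fin[of "lattice_min L"]]) (auto simp: min_vectors_def)
  \<comment> \<open>Vectors longer than \<open>x\<close> cannot be shortest, so finitely many norms
    compete.\<close>
  define T where "T = norm ` ((L - {0}) \<inter> cball 0 (norm x))"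
  have T: "finite T" "T \<noteq> {}"
    unfolding T_def using assms by (auto intro: finite_subset[OF _ fin[of "norm x"]])
  then have "Min T \<in> T" by simp
  then obtain y where "y \<in> (L - {0}) \<inter> cball 0 (norm x)" "Min T = norm y"
    by (auto simp only: T_def)
  then have y: "y \<in> L" "y \<noteq> 0" "norm y \<le> norm x" "Min T = norm y"
    by auto
  have "lattice_min L = norm y"
    unfolding lattice_min_def
  proof (rule Least_equality)
    fix r assume "\<exists>z\<in>L - {0}. r = norm z"
    then obtain z where z: "z \<in> L" "z \<noteq> 0" "r = norm z" by auto
    show "norm y \<le> r"
    proof (cases "r \<le> norm x")
      case True
      with z have "r \<in> T" by (auto simp: T_def)
      then show ?thesis using T y by (metis Min_le)
    qed (use y in auto)
  qed (use y in auto)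
  with y show "\<exists>y\<in>min_vectors L. y \<noteq> 0"
    by (auto simp: min_vectors_def)
qed

section \<open>The action of graph automorphisms\<close>

text \<open>The inverse moves the entry at \<open>i\<close> to position \<open>\<tau> i\<close> and
  makes this a left action.\<close>

definition permute_coords :: "('n \<Rightarrow> 'n) \<Rightarrow> real ^ 'n::finite \<Rightarrow> real ^ 'n"
  where "permute_coords \<tau> v = (\<chi> i. v $ inv_into UNIV \<tau> i)"

lemma permute_coords_comp:
  assumes "bij \<sigma>" "bij \<tau>"
  shows "permute_coords (\<sigma> \<circ> \<tau>) v = permute_coords \<sigma> (permute_coords \<tau> v)"
  using assms by (simp add: permute_coords_def o_inv_distrib vec_eq_iff)

lemma permute_coords_inv:
  assumes "bij \<tau>"
  shows "permute_coords \<tau> (permute_coords (inv_into UNIV \<tau>) v) = v"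
    "permute_coords (inv_into UNIV \<tau>) (permute_coords \<tau> v) = v"
  using assms by (simp_all add: permute_coords_def inv_inv_eq bij_is_inj bij_is_surj surj_f_inv_f)

lemma linear_permute_coords: "linear (permute_coords \<tau>)"
  by (rule linearI) (simp_all add: permute_coords_def vec_eq_iff)

lemma permute_coords_nth:
  assumes "bij \<tau>"
  shows "permute_coords \<tau> v $ \<tau> i = v $ i"
  using assms by (simp add: permute_coords_def bij_is_inj)

lemma permute_coords_inner:
  assumes "bij \<tau>"
  shows "permute_coords \<tau> v \<bullet> permute_coords \<tau> w = v \<bullet> w"
  using sum.reindex_bij_betw[OF bij_imp_bij_inv[OF assms], of "\<lambda>i. v $ i * w $ i"]
  by (simp add: permute_coords_def inner_vec_def)

lemma permute_coords_norm:
  assumes "bij \<tau>"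
  shows "norm (permute_coords \<tau> v) = norm v"
  using permute_coords_inner[OF assms] by (simp add: norm_eq)

text \<open>Reduces invariance of a set under all automorphisms to inclusions, since inverses are
  automorphisms too.\<close>

lemma permute_coords_image_eqI:
  assumes "bij \<tau>" "permute_coords \<tau> ` S \<subseteq> S" "permute_coords (inv_into UNIV \<tau>) ` S \<subseteq> S"
  shows "permute_coords \<tau> ` S = S"
  using assms permute_coords_inv(1)[OF assms(1)] by (metis image_subset_iff subsetI subset_antisym image_eqI)

lemma permute_coords_integer:
  "z \<in> integer_vectors \<Longrightarrow> permute_coords \<tau> z \<in> integer_vectors"
  by (simp add: integer_vectors_def permute_coords_def)

lemma graph_auts_bij: "\<tau> \<in> graph_auts E \<Longrightarrow> bij \<tau>"
  by (simp add: graph_auts_def)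

lemma graph_auts_inv: "\<tau> \<in> graph_auts E \<Longrightarrow> inv_into UNIV \<tau> \<in> graph_auts E"
  unfolding graph_auts_def by (auto simp: bij_imp_bij_inv) (metis bij_inv_eq_iff)+

lemma graph_auts_comp: "\<sigma> \<in> graph_auts E \<Longrightarrow> \<tau> \<in> graph_auts E \<Longrightarrow> \<sigma> \<circ> \<tau> \<in> graph_auts E"
  by (auto simp: graph_auts_def bij_comp)

lemma graph_auts_id: "(\<lambda>x. x) \<in> graph_auts E"
  using bij_id by (auto simp: graph_auts_def id_def)

text \<open>Such a matrix is constant on the orbits of the automorphism group on pairs of
  vertices.\<close>

definition aut_invariant :: "('n::finite \<Rightarrow> 'n \<Rightarrow> bool) \<Rightarrow> real ^ 'n ^ 'n \<Rightarrow> bool"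
  where "aut_invariant E M \<longleftrightarrow> (\<forall>\<tau>\<in>graph_auts E. \<forall>i j. M $ \<tau> i $ \<tau> j = M $ i $ j)"

lemma aut_invariant_adjacency_matrix: "aut_invariant E (adjacency_matrix E)"
  by (auto simp: aut_invariant_def adjacency_matrix_def graph_auts_def)

lemma aut_invariant_mat: "aut_invariant E (mat c)"
  by (auto simp: aut_invariant_def mat_def graph_auts_def dest: bij_is_inj injD)

lemma aut_invariant_mult:
  assumes "aut_invariant E M" "aut_invariant E N"
  shows "aut_invariant E (M ** N)"
  unfolding aut_invariant_def
proof (intro ballI allI)
  fix \<tau> i j assume \<tau>: "\<tau> \<in> graph_auts E"
  have "(M ** N) $ \<tau> i $ \<tau> j = (\<Sum>k\<in>UNIV. M $ \<tau> i $ \<tau> k * N $ \<tau> k $ \<tau> j)"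
    using sum.reindex_bij_betw[OF graph_auts_bij[OF \<tau>], of "\<lambda>k. M $ \<tau> i $ k * N $ k $ \<tau> j"]
    by (simp add: matrix_matrix_mult_def)
  also have "\<dots> = (M ** N) $ i $ j"
    using assms \<tau> by (simp add: aut_invariant_def matrix_matrix_mult_def)
  finally show "(M ** N) $ \<tau> i $ \<tau> j = (M ** N) $ i $ j" .
qed

lemma aut_invariant_diff_scaleR:
  "aut_invariant E M \<Longrightarrow> aut_invariant E N \<Longrightarrow> aut_invariant E (M - c *\<^sub>R N)"
  by (simp add: aut_invariant_def)

text \<open>Reindexing the row sums by \<open>\<tau>\<close> turns invariance of the entries into
  commutation with the action.\<close>

lemma aut_invariant_permute_coords:
  assumes M: "aut_invariant E M" and \<tau>: "\<tau> \<in> graph_auts E"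
  shows "M *v permute_coords \<tau> v = permute_coords \<tau> (M *v v)"
proof (rule vec_eq_iff[THEN iffD2], rule allI)
  fix i
  note bij = graph_auts_bij[OF \<tau>]
  obtain k where k: "i = \<tau> k"
    using bij by (meson bij_pointE)
  have "(M *v permute_coords \<tau> v) $ i = (\<Sum>j\<in>UNIV. M $ \<tau> k $ \<tau> j * permute_coords \<tau> v $ \<tau> j)"
    using sum.reindex_bij_betw[OF bij, of "\<lambda>j. M $ \<tau> k $ j * permute_coords \<tau> v $ j"]
    by (simp add: matrix_vector_mult_def k)
  also have "\<dots> = permute_coords \<tau> (M *v v) $ i"
    using M \<tau> by (simp add: aut_invariant_def k permute_coords_nth[OF bij] matrix_vector_mult_def)
  finally show "(M *v permute_coords \<tau> v) $ i = permute_coords \<tau> (M *v v) $ i" .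
qed

section \<open>Invariance of the eigenspace, the lattice and its minimal vectors\<close>

lemma subspace_graph_eigenspace: "subspace (graph_eigenspace E l)"
  by (simp add: graph_eigenspace_def subspace_eigenspace)

lemma permute_coords_graph_eigenspace:
  assumes "\<tau> \<in> graph_auts E"
  shows "permute_coords \<tau> ` graph_eigenspace E l = graph_eigenspace E l"
proof (rule permute_coords_image_eqI[OF graph_auts_bij[OF assms]])
  have "permute_coords \<sigma> ` graph_eigenspace E l \<subseteq> graph_eigenspace E l" if "\<sigma> \<in> graph_auts E" for \<sigma>
    by (auto simp: graph_eigenspace_def eigenspace_def
        aut_invariant_permute_coords[OF aut_invariant_adjacency_matrix that]
        linear_scale[OF linear_permute_coords])
  with assms graph_auts_inv[OF assms]
  show "permute_coords \<tau> ` graph_eigenspace E l \<subseteq> graph_eigenspace E l"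
    "permute_coords (inv_into UNIV \<tau>) ` graph_eigenspace E l \<subseteq> graph_eigenspace E l"
    by blast+
qed

text \<open>An orthogonal map that preserves \<open>V\<close> also preserves its orthogonal
  complement, hence commutes with the projection.\<close>

lemma orth_proj_permute_coords:
  assumes V: "subspace V" and \<tau>: "bij \<tau>" "permute_coords \<tau> ` V = V"
  shows "orth_proj V (permute_coords \<tau> x) = permute_coords \<tau> (orth_proj V x)"
proof (rule orth_proj_eqI[OF V])
  show "permute_coords \<tau> (orth_proj V x) \<in> V"
    using orth_proj(1)[OF V] \<tau>(2) by blast
  fix v assume "v \<in> V"
  then obtain w where w: "w \<in> V" "v = permute_coords \<tau> w"
    using \<tau>(2) by blast
  then show "orthogonal (permute_coords \<tau> x - permute_coords \<tau> (orth_proj V x)) v"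
    using orth_proj(2)[OF V w(1), of x]
    by (simp add: orthogonal_def permute_coords_inner[OF \<tau>(1)]
        flip: linear_diff[OF linear_permute_coords])
qed

lemma graph_lattice_eq: "graph_lattice E l = orth_proj (graph_eigenspace E l) ` integer_vectors"
  by (simp add: graph_lattice_def proj_matrix_mult[OF subspace_graph_eigenspace])

lemma permute_coords_graph_lattice:
  assumes "\<tau> \<in> graph_auts E"
  shows "permute_coords \<tau> ` graph_lattice E l = graph_lattice E l"
proof (rule permute_coords_image_eqI[OF graph_auts_bij[OF assms]])
  have "permute_coords \<sigma> ` graph_lattice E l \<subseteq> graph_lattice E l" if "\<sigma> \<in> graph_auts E" for \<sigma>
    using permute_coords_integer[of _ \<sigma>]
    by (auto intro!: imageI simp: graph_lattice_eq simp flip: orth_proj_permute_coords[OF subspace_graph_eigenspace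
          graph_auts_bij[OF that] permute_coords_graph_eigenspace[OF that]])
  with assms graph_auts_inv[OF assms]
  show "permute_coords \<tau> ` graph_lattice E l \<subseteq> graph_lattice E l"
    "permute_coords (inv_into UNIV \<tau>) ` graph_lattice E l \<subseteq> graph_lattice E l"
    by blast+
qed

text \<open>An isometry preserving the lattice permutes its shortest vectors. The bijection later
  reindexes the sum over them.\<close>

lemma permute_coords_min_vectors:
  assumes "\<tau> \<in> graph_auts E"
  shows "bij_betw (permute_coords \<tau>) (min_vectors (graph_lattice E l)) (min_vectors (graph_lattice E l))"
proof (rule bij_betwI')
  note bij = graph_auts_bij[OF assms]
  have mem: "permute_coords \<sigma> x \<in> min_vectors (graph_lattice E l)"
    if "\<sigma> \<in> graph_auts E" "x \<in> min_vectors (graph_lattice E l)" for \<sigma> x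
    using that permute_coords_graph_lattice[OF that(1), of l] permute_coords_norm[OF graph_auts_bij[OF that(1)], of x]
    by (auto simp: min_vectors_def)
  show "(permute_coords \<tau> x = permute_coords \<tau> y) = (x = y)" for x y
    using permute_coords_inv(2)[OF bij] by metis
  show "permute_coords \<tau> x \<in> min_vectors (graph_lattice E l)"
    if "x \<in> min_vectors (graph_lattice E l)" for x
    by (rule mem[OF assms that])
  show "\<exists>x\<in>min_vectors (graph_lattice E l). y = permute_coords \<tau> x"
    if "y \<in> min_vectors (graph_lattice E l)" for y
    using mem[OF graph_auts_inv[OF assms] that] permute_coords_inv(1)[OF bij] by metis
qed

section \<open>The two automorphism groups and the homomorphism between them\<close>

lemma subgroup_graph_auts: "subgroup (graph_auts E) (BijGroup UNIV)"
proof (rule group.subgroupI[OF group_BijGroup])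
  show "graph_auts E \<subseteq> carrier (BijGroup UNIV)"
    by (auto simp: BijGroup_def Bij_def graph_auts_def)
  show "graph_auts E \<noteq> {}"
    using graph_auts_id by blast
  fix \<sigma> assume \<sigma>: "\<sigma> \<in> graph_auts E"
  then have "\<sigma> \<in> Bij UNIV"
    by (auto simp: Bij_def graph_auts_def)
  then show "inv\<^bsub>BijGroup UNIV\<^esub> \<sigma> \<in> graph_auts E"
    using graph_auts_inv[OF \<sigma>] by (simp add: inv_BijGroup restrict_UNIV)
  fix \<tau> assume \<tau>: "\<tau> \<in> graph_auts E"
  with \<sigma> show "\<sigma> \<otimes>\<^bsub>BijGroup UNIV\<^esub> \<tau> \<in> graph_auts E"
    using graph_auts_comp[OF \<sigma> \<tau>]
    by (auto simp: BijGroup_def Bij_def compose_def o_def graph_auts_bij restrict_UNIV)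
qed

lemma group_graph_aut_group: "group (graph_aut_group E)"
  unfolding graph_aut_group_def
  by (rule subgroup.subgroup_is_group[OF subgroup_graph_auts group_BijGroup])

lemma subgroup_lattice_auts:
  assumes V: "subspace V" and "L \<subseteq> V"
  shows "subgroup {f \<in> orthogonal_transformations_on V. f ` L = L} (BijGroup V)" (is "subgroup ?S _")
proof (rule group.subgroupI[OF group_BijGroup])
  note cl = subspace_add[OF V] subspace_scale[OF V]
  show "?S \<subseteq> carrier (BijGroup V)"
    by (auto simp: BijGroup_def orthogonal_transformations_on_def)
  \<comment> \<open>Members of \<open>Bij V\<close> are undefined outside \<open>V\<close>, so the
    identity here and the inverses below are restricted to \<open>V\<close>.\<close>
  have "(\<lambda>x\<in>V. x) \<in> ?S"
    using \<open>L \<subseteq> V\<close> by (auto simp: orthogonal_transformations_on_def id_Bij cl image_iff)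
  then show "?S \<noteq> {}" by blast
  fix f assume f: "f \<in> ?S"
  then have fB: "f \<in> Bij V" and fadd: "\<And>x y. x \<in> V \<Longrightarrow> y \<in> V \<Longrightarrow> f (x + y) = f x + f y"
    and fscale: "\<And>c x. x \<in> V \<Longrightarrow> f (c *\<^sub>R x) = c *\<^sub>R f x"
    and finner: "\<And>x y. x \<in> V \<Longrightarrow> y \<in> V \<Longrightarrow> f x \<bullet> f y = x \<bullet> y" and fL: "f ` L = L"
    by (auto simp: orthogonal_transformations_on_def)
  from fB have bij: "bij_betw f V V" and fV: "\<And>x. x \<in> V \<Longrightarrow> f x \<in> V"
    by (auto simp: Bij_def bij_betw_def)
  let ?g = "inv_into V f"
  have gV: "?g x \<in> V" and fg: "f (?g x) = x" if "x \<in> V" for x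
    using that bij by (auto simp: bij_betw_def inv_into_into f_inv_into_f)
  have gf: "?g (f x) = x" if "x \<in> V" for x
    using that bij by (simp add: bij_betw_def)
  have "(\<lambda>x\<in>V. ?g x) \<in> ?S"
  \<comment> \<open>Each property of the inverse follows from that of \<open>f\<close> by writing
    the arguments as values of \<open>f\<close>.\<close>
  proof (simp add: orthogonal_transformations_on_def restrict_inv_into_Bij[OF fB] cl del: restrict_apply, intro conjI ballI allI)
    show "(\<lambda>x\<in>V. ?g x) (x + y) = (\<lambda>x\<in>V. ?g x) x + (\<lambda>x\<in>V. ?g x) y" if "x \<in> V" "y \<in> V" for x y
      using that by (simp add: cl) (metis fadd fg gV gf cl(1))
    show "(\<lambda>x\<in>V. ?g x) (c *\<^sub>R x) = c *\<^sub>R (\<lambda>x\<in>V. ?g x) x" if "x \<in> V" for c x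
      using that by (simp add: cl) (metis fscale fg gV gf cl(2))
    show "(\<lambda>x\<in>V. ?g x) x \<bullet> (\<lambda>x\<in>V. ?g x) y = x \<bullet> y" if "x \<in> V" "y \<in> V" for x y
      using that by simp (metis finner fg gV)
    have "(\<lambda>x\<in>V. ?g x) ` L = ?g ` f ` L"
      using fL \<open>L \<subseteq> V\<close> by (auto intro!: image_cong)
    also have "\<dots> = (\<lambda>x. x) ` L"
      unfolding image_image by (rule image_cong) (use gf \<open>L \<subseteq> V\<close> in auto)
    finally show "(\<lambda>x\<in>V. ?g x) ` L = L" by simp
  qed
  then show "inv\<^bsub>BijGroup V\<^esub> f \<in> ?S"
    by (simp only: inv_BijGroup[OF fB])
  fix h assume h: "h \<in> ?S"
  then have hB: "h \<in> Bij V" and hL: "h ` L = L" and hV: "\<And>x. x \<in> V \<Longrightarrow> h x \<in> V"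
    by (auto simp: orthogonal_transformations_on_def Bij_def bij_betw_def)
  have "compose V f h ` L = f ` h ` L"
    unfolding image_image by (rule image_cong) (use \<open>L \<subseteq> V\<close> in \<open>auto simp: compose_def\<close>)
  then have "compose V f h ` L = L" using fL hL by simp
  moreover have "compose V f h \<in> orthogonal_transformations_on V"
    using h by (simp add: orthogonal_transformations_on_def compose_Bij[OF fB hB])
      (auto simp: compose_def cl fadd fscale finner hV)
  ultimately show "f \<otimes>\<^bsub>BijGroup V\<^esub> h \<in> ?S"
    using fB hB by (simp add: BijGroup_def)
qed

lemma group_lattice_aut_group:
  assumes "subspace V" "L \<subseteq> V"
  shows "group (lattice_aut_group V L)"
  unfolding lattice_aut_group_def
  by (rule subgroup.subgroup_is_group[OF subgroup_lattice_auts[OF assms] group_BijGroup])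

lemma graph_lattice_subset: "graph_lattice E l \<subseteq> graph_eigenspace E l"
  using orth_proj(1)[OF subspace_graph_eigenspace] by (auto simp: graph_lattice_eq)

lemma restrict_permute_coords_lattice_aut:
  assumes \<tau>: "\<tau> \<in> graph_auts E"
  shows "restrict (permute_coords \<tau>) (graph_eigenspace E l)
    \<in> carrier (lattice_aut_group (graph_eigenspace E l) (graph_lattice E l))"
proof -
  let ?V = "graph_eigenspace E l" and ?L = "graph_lattice E l"
  let ?f = "restrict (permute_coords \<tau>) ?V"
  note bij = graph_auts_bij[OF \<tau>]
  note sub = subspace_graph_eigenspace[of E l]
  have "inj_on (permute_coords \<tau>) ?V"
    using permute_coords_inv(2)[OF bij] by (metis inj_on_inverseI)
  then have "?f \<in> Bij ?V"
    using permute_coords_graph_eigenspace[OF \<tau>, of l] by (simp add: Bij_def bij_betw_def inj_on_def)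
  then have "?f \<in> orthogonal_transformations_on ?V"
    by (simp add: orthogonal_transformations_on_def subspace_add[OF sub] subspace_scale[OF sub]
        linear_add[OF linear_permute_coords] linear_scale[OF linear_permute_coords]
        permute_coords_inner[OF bij])
  moreover have "?f ` ?L = permute_coords \<tau> ` ?L"
    using graph_lattice_subset[of E l] by (intro image_cong) auto
  ultimately show ?thesis
    by (simp add: lattice_aut_group_def permute_coords_graph_lattice[OF \<tau>])
qed

text \<open>The action on the eigenspace need not be faithful: constant vectors, for instance, are
  fixed by every automorphism. Hence only a factor group appears.\<close>

lemma permute_coords_hom:
  "(\<lambda>\<tau>. restrict (permute_coords \<tau>) (graph_eigenspace E l))
    \<in> hom (graph_aut_group E) (lattice_aut_group (graph_eigenspace E l) (graph_lattice E l))"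
    (is "?h \<in> hom ?G ?H")
proof (rule homI)
  let ?V = "graph_eigenspace E l"
  show "?h \<tau> \<in> carrier ?H" if "\<tau> \<in> carrier ?G" for \<tau>
    using that by (intro restrict_permute_coords_lattice_aut) (simp add: graph_aut_group_def)
  fix \<sigma> \<tau> assume "\<sigma> \<in> carrier ?G" "\<tau> \<in> carrier ?G"
  then have s: "\<sigma> \<in> graph_auts E" and t: "\<tau> \<in> graph_auts E"
    by (simp_all add: graph_aut_group_def)
  have mult: "\<sigma> \<otimes>\<^bsub>?G\<^esub> \<tau> = \<sigma> \<circ> \<tau>"
    using s t by (auto simp: graph_aut_group_def BijGroup_def Bij_def graph_auts_bij compose_def)
  have B: "?h \<sigma> \<in> Bij ?V" "?h \<tau> \<in> Bij ?V"
    using restrict_permute_coords_lattice_aut[OF s, of l] restrict_permute_coords_lattice_aut[OF t, of l]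
    by (simp_all add: lattice_aut_group_def orthogonal_transformations_on_def)
  have "?h \<sigma> \<otimes>\<^bsub>?H\<^esub> ?h \<tau> = compose ?V (?h \<sigma>) (?h \<tau>)"
    using B by (simp add: lattice_aut_group_def BijGroup_def)
  \<comment> \<open>Since \<open>\<tau>\<close> maps the eigenspace to itself, the outer restriction
    is never left.\<close>
  also have "\<dots> = ?h (\<sigma> \<circ> \<tau>)"
    using permute_coords_graph_eigenspace[OF t, of l]
    by (auto simp: compose_def fun_eq_iff permute_coords_comp[OF graph_auts_bij[OF s] graph_auts_bij[OF t]])
  finally show "?h (\<sigma> \<otimes>\<^bsub>?G\<^esub> \<tau>) = ?h \<sigma> \<otimes>\<^bsub>?H\<^esub> ?h \<tau>"
    using mult by simp
qed

text \<open>First isomorphism theorem without surjectivity: shrinking the codomain to the image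
  leaves the kernel unchanged.\<close>

lemma (in group_hom) FactGroup_kernel_iso_image:
  "subgroup (h ` carrier G) H" "G Mod kernel G H h \<cong> H\<lparr>carrier := h ` carrier G\<rparr>"
proof -
  show sub: "subgroup (h ` carrier G) H"
    by (rule img_is_subgroup)
  let ?H = "H\<lparr>carrier := h ` carrier G\<rparr>"
  interpret I: group_hom G ?H h
    using subgroup.subgroup_is_group[OF sub H.group_axioms] homh
    by (intro group_hom.intro group_hom_axioms.intro) (auto simp: hom_def G.group_axioms)
  have "kernel G ?H h = kernel G H h"
    by (simp add: kernel_def)
  then show "G Mod kernel G H h \<cong> ?H"
    using I.FactGroup_iso by simp
qed

section \<open>Distance transitive graphs\<close>

text \<open>Connectivity provides some path, so the \<open>LEAST\<close> in
  \<open>graph_dist\<close> is attained.\<close>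

lemma graph_dist_path:
  assumes "graph_connected E"
  obtains xs where "graph_path E i xs j" "length xs = Suc (graph_dist E i j)"
proof -
  obtain xs where "graph_path E i xs j"
    using assms by (auto simp: graph_connected_def)
  moreover from this have "length xs = Suc (length xs - 1)"
    by (cases xs) (auto simp: graph_path_def)
  ultimately have "\<exists>k xs. graph_path E i xs j \<and> length xs = Suc k"
    by blast
  then have "\<exists>xs. graph_path E i xs j \<and> length xs = Suc (graph_dist E i j)"
    unfolding graph_dist_def by (rule LeastI_ex)
  with that show thesis by blast
qed

lemma graph_dist_le:
  assumes "graph_path E i xs j" "length xs \<le> Suc k"
  shows "graph_dist E i j \<le> k"
proof -
  have "length xs = Suc (length xs - 1)"
    using assms(1) by (cases xs) (auto simp: graph_path_def)
  with assms(1) have "graph_dist E i j \<le> length xs - 1"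
    unfolding graph_dist_def by (intro Least_le) blast
  with assms(2) show ?thesis by linarith
qed

text \<open>Paths have distinct vertices, so \<open>i\<close> can be prepended to a shortest path
  from \<open>k\<close> only if it is not on it. Otherwise the part of that path from
  \<open>i\<close> on is a path that is no longer.\<close>

lemma graph_dist_Suc:
  assumes "graph_connected E" "E i k"
  shows "graph_dist E i j \<le> Suc (graph_dist E k j)"
proof -
  obtain xs where xs: "graph_path E k xs j" "length xs = Suc (graph_dist E k j)"
    using graph_dist_path[OF assms(1)] by blast
  show ?thesis
  proof (cases "i \<in> set xs")
    case False
    with xs assms(2) have "graph_path E i (i # xs) j"
      by (auto simp: graph_path_def successively_Cons)
    with xs show ?thesis by (intro graph_dist_le) auto
  next
    case True
    then obtain ys zs where "xs = ys @ i # zs"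
      by (meson split_list)
    with xs have "graph_path E i (i # zs) j" "length (i # zs) \<le> length xs"
      by (auto simp: graph_path_def successively_append_iff)
    with xs show ?thesis by (intro graph_dist_le[of _ _ "i # zs"]) auto
  qed
qed

text \<open>For an adjacency matrix the entries count walks with \<open>k\<close> edges, in which
  vertices may repeat.\<close>

primrec mat_power :: "real ^ 'n ^ 'n \<Rightarrow> nat \<Rightarrow> real ^ 'n ^ 'n"
  where "mat_power A 0 = mat 1"
  | "mat_power A (Suc k) = A ** mat_power A k"

lemma aut_invariant_mat_power:
  "aut_invariant E A \<Longrightarrow> aut_invariant E (mat_power A k)"
  by (induction k) (simp_all add: aut_invariant_mat aut_invariant_mult)

lemma mat_power_eigenvector:
  assumes "A *v v = l *\<^sub>R v"
  shows "mat_power A k *v v = (l ^ k) *\<^sub>R v"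
  by (induction k)
    (simp_all add: assms matrix_vector_mult_scaleR mult.commute flip: matrix_vector_mul_assoc)

lemma mat_power_adjacency_nonneg: "mat_power (adjacency_matrix E) k $ i $ j \<ge> 0"
  by (induction k arbitrary: i)
    (auto simp: mat_def matrix_matrix_mult_def adjacency_matrix_def intro!: sum_nonneg)

text \<open>A nonzero entry yields a first edge from \<open>i\<close> to some \<open>s\<close> and a
  nonzero entry of the previous power at \<open>s\<close>; one edge changes the distance by at most
  1.\<close>

lemma mat_power_adjacency_dist:
  assumes "graph_connected E" "mat_power (adjacency_matrix E) k $ i $ j \<noteq> 0"
  shows "graph_dist E i j \<le> k"
  using assms(2)
proof (induction k arbitrary: i)
  case 0
  then have "graph_path E i [i] j"
    by (auto simp: mat_def graph_path_def split: if_splits)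
  then show ?case by (rule graph_dist_le) simp
next
  case (Suc k)
  then obtain s where "adjacency_matrix E $ i $ s * mat_power (adjacency_matrix E) k $ s $ j \<noteq> 0"
    by (auto simp: matrix_matrix_mult_def elim: sum.not_neutral_contains_not_neutral)
  then have "E i s" "graph_dist E s j \<le> k"
    using Suc.IH by (auto simp: adjacency_matrix_def split: if_splits)
  then show ?case
    using graph_dist_Suc[OF assms(1), of i s j] by linarith
qed

text \<open>All terms are nonnegative, so the contribution of the given walk cannot cancel. For a
  shortest path this makes the entry at distance exactly \<open>k\<close> a valid divisor.\<close>

lemma mat_power_adjacency_walk:
  "successively E xs \<Longrightarrow> length xs = Suc k \<Longrightarrow>
    mat_power (adjacency_matrix E) k $ hd xs $ last xs > 0"
proof (induction k arbitrary: xs)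
  case 0
  then obtain x where "xs = [x]" by (auto simp: length_Suc_conv)
  then show ?case by (simp add: mat_def)
next
  case (Suc k)
  then obtain x y ys where xs: "xs = x # y # ys"
    by (auto simp: length_Suc_conv)
  let ?W = "mat_power (adjacency_matrix E) k"
  have "?W $ y $ last xs > 0" "E x y"
    using Suc.IH[of "y # ys"] Suc.prems by (auto simp: xs)
  then have "0 < adjacency_matrix E $ x $ y * ?W $ y $ last xs"
    by (simp add: adjacency_matrix_def)
  also have "\<dots> \<le> (\<Sum>z\<in>UNIV. adjacency_matrix E $ x $ z * ?W $ z $ last xs)"
  proof (rule member_le_sum)
    show "0 \<le> adjacency_matrix E $ x $ z * ?W $ z $ last xs" for z
      by (intro mult_nonneg_nonneg mat_power_adjacency_nonneg) (simp add: adjacency_matrix_def)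
  qed auto
  finally show ?case
    by (simp add: matrix_matrix_mult_def xs)
qed

text \<open>
  The invariant matrices are the combinations of the distance matrices, and subtracting a multiple
  of \<open>A ^ k\<close> removes the part supported at the largest distance \<open>k\<close>; so they are
  polynomials in \<open>A\<close>, which is why they act as scalars on its eigenspaces.
\<close>

lemma aut_invariant_scalar_on_eigenspace:
  fixes M :: "real ^ 'n ^ 'n::finite"
  assumes dt: "distance_transitive E" and "aut_invariant E M"
    and "\<And>i j. k \<le> graph_dist E i j \<Longrightarrow> M $ i $ j = 0"
  shows "\<exists>\<mu>. \<forall>v\<in>graph_eigenspace E l. M *v v = \<mu> *\<^sub>R v"
  using assms(2,3)
proof (induction k arbitrary: M)
  case 0
  \<comment> \<open>Every distance is at least 0, so all entries vanish.\<close>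
  then have "M = 0" by (simp add: vec_eq_iff)
  then show ?case by (auto intro: exI[of _ 0])
next
  case (Suc k)
  let ?W = "mat_power (adjacency_matrix E) k"
  have conn: "graph_connected E"
    using dt by (simp add: distance_transitive_def)
  have inv: "aut_invariant E ?W"
    by (intro aut_invariant_mat_power aut_invariant_adjacency_matrix)
  \<comment> \<open>The pairs at distance \<open>k\<close> form one orbit, on which \<open>M\<close>
    and \<open>?W\<close> are both constant, with \<open>?W\<close> positive. If there are no such
    pairs, any \<open>c\<close> works.\<close>
  have "\<exists>c. \<forall>i j. graph_dist E i j = k \<longrightarrow> M $ i $ j = c * ?W $ i $ j"
  proof (cases "\<exists>i j. graph_dist E i j = k")
    case True
    then obtain p q where pq: "graph_dist E p q = k" by blast
    obtain xs where "graph_path E p xs q" "length xs = Suc k"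
      using graph_dist_path[OF conn, of p q] pq by metis
    then have "?W $ p $ q > 0"
      using mat_power_adjacency_walk[of E xs k] by (auto simp: graph_path_def)
    moreover have "M $ i $ j = M $ p $ q \<and> ?W $ i $ j = ?W $ p $ q" if "graph_dist E i j = k" for i j
    proof -
      obtain \<tau> where "\<tau> \<in> graph_auts E" "\<tau> p = i" "\<tau> q = j"
        using dt pq \<open>graph_dist E i j = k\<close> unfolding distance_transitive_def by metis
      with Suc.prems(1) inv show ?thesis
        unfolding aut_invariant_def by metis
    qed
    ultimately show ?thesis
      by (intro exI[of _ "M $ p $ q / ?W $ p $ q"]) auto
  qed auto
  then obtain c where c: "\<And>i j. graph_dist E i j = k \<Longrightarrow> M $ i $ j = c * ?W $ i $ j"
    by blast
  have "\<exists>\<mu>. \<forall>v\<in>graph_eigenspace E l. (M - c *\<^sub>R ?W) *v v = \<mu> *\<^sub>R v"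
  proof (rule Suc.IH)
    show "aut_invariant E (M - c *\<^sub>R ?W)"
      by (intro aut_invariant_diff_scaleR Suc.prems(1) inv)
    \<comment> \<open>At distance \<open>k\<close> the choice of \<open>c\<close> cancels the
      entries; farther away \<open>M\<close> vanishes by hypothesis and \<open>?W\<close> because
      walks of \<open>k\<close> edges are too short.\<close>
    show "(M - c *\<^sub>R ?W) $ i $ j = 0" if "k \<le> graph_dist E i j" for i j
    proof (cases "graph_dist E i j = k")
      case False
      with that have "M $ i $ j = 0" "?W $ i $ j = 0"
        using Suc.prems(2)[of i j] mat_power_adjacency_dist[OF conn, of k i j] by auto
      then show ?thesis by simp
    qed (simp add: c)
  qed
  then obtain \<mu> where \<mu>: "\<And>v. v \<in> graph_eigenspace E l \<Longrightarrow> (M - c *\<^sub>R ?W) *v v = \<mu> *\<^sub>R v"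
    by blast
  have "M *v v = (\<mu> + c * l ^ k) *\<^sub>R v" if v: "v \<in> graph_eigenspace E l" for v
  proof -
    have "?W *v v = (l ^ k) *\<^sub>R v"
      using v by (intro mat_power_eigenvector) (simp add: graph_eigenspace_def eigenspace_def)
    then show ?thesis
      using \<mu>[OF v]
      by (simp add: matrix_vector_mult_diff_rdistrib algebra_simps flip: scaleR_matrix_vector_assoc)
  qed
  then show ?case by blast
qed

text \<open>The matrix is the sum of the outer products \<open>x x\<^sup>T\<close>, so its quadratic
  form is the sum in the definition of strong eutaxy.\<close>

lemma inner_gram_matrix:
  fixes S :: "(real ^ 'n) set"
  shows "v \<bullet> ((\<chi> i j. \<Sum>x\<in>S. x $ i * x $ j) *v v) = (\<Sum>x\<in>S. (v \<bullet> x)\<^sup>2)"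
proof -
  have "(\<Sum>x\<in>S. (v \<bullet> x)\<^sup>2) = (\<Sum>x\<in>S. \<Sum>i\<in>UNIV. \<Sum>j\<in>UNIV. v $ i * (x $ i * x $ j * v $ j))"
    by (simp add: power2_eq_square inner_vec_def sum_product ac_simps)
  also have "\<dots> = (\<Sum>i\<in>UNIV. \<Sum>j\<in>UNIV. \<Sum>x\<in>S. v $ i * (x $ i * x $ j * v $ j))"
    by (subst sum.swap) (intro sum.cong refl sum.swap)
  also have "\<dots> = v \<bullet> ((\<chi> i j. \<Sum>x\<in>S. x $ i * x $ j) *v v)"
    by (simp add: inner_vec_def matrix_vector_mult_def sum_distrib_left sum_distrib_right)
  finally show ?thesis by simp
qed

lemma strongly_eutactic_graph_lattice:
  fixes E :: "'n::finite \<Rightarrow> 'n \<Rightarrow> bool"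
  assumes dt: "distance_transitive E" and disc: "uniformly_discrete (graph_lattice E l)"
    and eig: "is_eigenvalue (adjacency_matrix E) l"
  shows "strongly_eutactic (graph_eigenspace E l) (graph_lattice E l)"
proof -
  let ?V = "graph_eigenspace E l" and ?L = "graph_lattice E l"
  let ?S = "min_vectors ?L"
  note V = subspace_graph_eigenspace[of E l]
  \<comment> \<open>If the lattice were zero, the projection would kill the standard basis, which is
    integral, and the eigenspace would be trivial.\<close>
  have "\<exists>x\<in>?L. x \<noteq> 0"
  proof (rule ccontr)
    assume *: "\<not> (\<exists>x\<in>?L. x \<noteq> 0)"
    have "orth_proj ?V b = 0" if "b \<in> Basis" for b
    proof -
      have "b \<in> integer_vectors"
        using that by (auto simp: integer_vectors_def Basis_vec_def axis_def)
      with * show ?thesis by (auto simp: graph_lattice_eq)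
    qed
    then have "orth_proj ?V v = 0" for v
      using linear_eq_stdbasis[OF linear_orth_proj[OF V] module_hom_zero] by (metis (no_types))
    then have "?V \<subseteq> {0}"
      using orth_proj_same[OF V] by auto
    with eig show False
      by (auto simp: is_eigenvalue_def graph_eigenspace_def eigenspace_def)
  qed
  then obtain y where fin: "finite ?S" and y: "y \<in> ?S" "y \<noteq> 0"
    using finite_min_vectors[OF disc] min_vectors_nonzero[OF disc] by metis
  define M :: "real ^ 'n ^ 'n" where "M = (\<chi> i j. \<Sum>x\<in>?S. x $ i * x $ j)"
  have "aut_invariant E M"
    unfolding aut_invariant_def
  proof (intro ballI allI)
    fix \<tau> i j assume \<tau>: "\<tau> \<in> graph_auts E"
    show "M $ \<tau> i $ \<tau> j = M $ i $ j"
      using sum.reindex_bij_betw[OF permute_coords_min_vectors[OF \<tau>], of "\<lambda>x. x $ \<tau> i * x $ \<tau> j" l]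
      by (simp add: M_def permute_coords_nth[OF graph_auts_bij[OF \<tau>]])
  qed
  \<comment> \<open>Starting the induction just above the largest distance makes its vanishing
    hypothesis vacuous.\<close>
  moreover have "graph_dist E i j \<le> Max (range (\<lambda>(i, j). graph_dist E i j))" for i j
    by (rule Max_ge) (auto intro: image_eqI[of _ _ "(i, j)"])
  then have "M $ i $ j = 0" if "Suc (Max (range (\<lambda>(i, j). graph_dist E i j))) \<le> graph_dist E i j" for i j
    using that by (meson not_less_eq_eq)
  ultimately obtain \<mu> where \<mu>: "\<And>v. v \<in> ?V \<Longrightarrow> M *v v = \<mu> *\<^sub>R v"
    using aut_invariant_scalar_on_eigenspace[OF dt] by metis
  have sum: "(\<Sum>x\<in>?S. (v \<bullet> x)\<^sup>2) = \<mu> * (norm v)\<^sup>2" if "v \<in> ?V" for v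
    using inner_gram_matrix[of v ?S] \<mu>[OF that] by (simp add: M_def power2_norm_eq_inner)
  have "y \<in> ?V"
    using y graph_lattice_subset[of E l] by (auto simp: min_vectors_def)
  \<comment> \<open>Testing a nonzero minimal vector against itself shows that the scalar
    \<open>\<mu>\<close> is positive, so \<open>1 / \<mu>\<close> can serve as eutaxy
    constant.\<close>
  have "0 < (y \<bullet> y)\<^sup>2"
    using y by simp
  also have "\<dots> \<le> (\<Sum>x\<in>?S. (y \<bullet> x)\<^sup>2)"
    using y fin by (intro member_le_sum) auto
  finally have "0 < \<mu> * (norm y)\<^sup>2"
    using sum[OF \<open>y \<in> ?V\<close>] by simp
  then have "\<mu> > 0"
    by (simp add: zero_less_mult_iff)
  then show ?thesis
    unfolding strongly_eutactic_def using sum by (intro exI[of _ "1 / \<mu>"]) simp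
qed

theorem theorem1p3:
  fixes E :: "'n::finite \<Rightarrow> 'n \<Rightarrow> bool" and l :: real and m :: nat
  assumes "simple_graph E"
    and "vertex_transitive E"
    and "is_eigenvalue (adjacency_matrix E) l"
    and "dim (graph_eigenspace E l) = m"
    and "l \<in> \<rat>"
  shows "(\<forall>i j. proj_matrix (graph_eigenspace E l) $ i $ j \<in> \<rat>) \<and>
    full_rank_lattice (graph_eigenspace E l) (graph_lattice E l) \<and>
    (\<exists>N H. N \<lhd> graph_aut_group E \<and>
       subgroup H (lattice_aut_group (graph_eigenspace E l) (graph_lattice E l)) \<and>
       (graph_aut_group E Mod N) \<cong>
         (lattice_aut_group (graph_eigenspace E l) (graph_lattice E l))\<lparr>carrier := H\<rparr>) \<and>
    (distance_transitive E \<longrightarrow>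
       strongly_eutactic (graph_eigenspace E l) (graph_lattice E l))"
proof (intro conjI impI)
  let ?V = "graph_eigenspace E l" and ?L = "graph_lattice E l"
  have "transpose (adjacency_matrix E) = adjacency_matrix E"
    using assms(1)
    by (auto simp: simple_graph_def transpose_def adjacency_matrix_def vec_eq_iff dest: sympD)
  then have rat: "proj_matrix ?V $ i $ j \<in> \<rat>" for i j
    unfolding graph_eigenspace_def using assms(5)
    by (intro proj_matrix_eigenspace_rational) (auto simp: adjacency_matrix_def)
  then show "\<forall>i j. proj_matrix ?V $ i $ j \<in> \<rat>" by blast
  show "full_rank_lattice ?V ?L"
    unfolding graph_lattice_def by (rule full_rank_lattice_proj[OF subspace_graph_eigenspace rat])
  interpret group_hom "graph_aut_group E" "lattice_aut_group ?V ?L"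
      "\<lambda>\<tau>. restrict (permute_coords \<tau>) ?V"
    by (intro group_hom.intro group_hom_axioms.intro group_graph_aut_group permute_coords_hom
        group_lattice_aut_group subspace_graph_eigenspace graph_lattice_subset)
  \<comment> \<open>\<open>N\<close> is the kernel of the action on the eigenspace and
    \<open>H\<close> its image.\<close>
  show "\<exists>N H. N \<lhd> graph_aut_group E \<and> subgroup H (lattice_aut_group ?V ?L) \<and>
      graph_aut_group E Mod N \<cong> (lattice_aut_group ?V ?L)\<lparr>carrier := H\<rparr>"
    using normal_kernel FactGroup_kernel_iso_image by blast
  assume "distance_transitive E"
  then show "strongly_eutactic ?V ?L"
    using assms(3) uniformly_discrete_rational_image[OF rat]
    by (intro strongly_eutactic_graph_lattice) (simp_all add: graph_lattice_def)
qed

end
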